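(* Let $X$ be a crowded compact Hausdorff zero-dimensional $F$-space in which nonempty $G_\delta$-subsets have nonempty interior. Then all countable subsets of $\mathcal{H}(X)$ are discrete (and hence closed and discrete).
   Context: A space is crowded if it has no isolated points. A space is zero-dimensional if it has a base of clopen sets. An $F$-space is a space in which cozero-subsets are $C^*$-embedded (for normal spaces: disjoint open $F_\sigma$-subsets have disjoint closures). A subset of a space is discrete if its subspace topology is discrete. For a compact Hausdorff space $X$, $\mathcal{H}(X)$ is the group of all homeomorphisms $X\to X$ under composition, endowed with the compact-open topology, i.e. the topology with subbase all sets $[K,U]=\{f\in\mathcal{H}(X): f(K)\subseteq U\}$, $K\subseteq X$ compact, $U\subseteq X$ open; it is a topological group. *)

theory Defs
  imports "HOL-Analysis.Analysis"
begin

definition crowded_space :: "'a topology \<Rightarrow> bool" where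
  "crowded_space X \<longleftrightarrow> (\<forall>x \<in> topspace X. \<not> openin X {x})"

definition zero_dimensional_space :: "'a topology \<Rightarrow> bool" where
  "zero_dimensional_space X \<longleftrightarrow>
     openin X = arbitrary union_of (\<lambda>U. openin X U \<and> closedin X U)"

definition cozero_in :: "'a topology \<Rightarrow> 'a set \<Rightarrow> bool" where
  "cozero_in X U \<longleftrightarrow>
     (\<exists>f. continuous_map X euclideanreal f \<and> U = {x \<in> topspace X. f x \<noteq> 0})"

definition C_star_embedded_in :: "'a topology \<Rightarrow> 'a set \<Rightarrow> bool" where
  "C_star_embedded_in X S \<longleftrightarrow>
     S \<subseteq> topspace X \<and>
     (\<forall>f. continuous_map (subtopology X S) euclideanreal f \<and> bounded (f ` S) \<longrightarrow>
        (\<exists>g. continuous_map X euclideanreal g \<and> bounded (g ` topspace X) \<and>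
             (\<forall>x\<in>S. g x = f x)))"

definition F_space :: "'a topology \<Rightarrow> bool" where
  "F_space X \<longleftrightarrow> (\<forall>U. cozero_in X U \<longrightarrow> C_star_embedded_in X U)"

text \<open>Self-homeomorphisms are taken extensional (equal to \<^term>\<open>undefined\<close> outside the
  space), so that each homeomorphism of the space is represented by exactly one function.\<close>

definition homeomorphisms :: "'a topology \<Rightarrow> ('a \<Rightarrow> 'a) set" where
  "homeomorphisms X = {f \<in> extensional (topspace X). homeomorphic_map X X f}"

text \<open>The choice of the empty set for \<open>K\<close> shows that the underlying set of this
  topology is all of \<^term>\<open>homeomorphisms X\<close>.\<close>

definition homeo_space :: "'a topology \<Rightarrow> ('a \<Rightarrow> 'a) topology" where
  "homeo_space X = topology_generated_by
     {{f \<in> homeomorphisms X. f ` K \<subseteq> U} | K U. compactin X K \<and> openin X U}"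

lemma topspace_homeo_space: "topspace (homeo_space X) = homeomorphisms X"
proof -
  have "homeomorphisms X \<in> {{f \<in> homeomorphisms X. f ` K \<subseteq> U} | K U. compactin X K \<and> openin X U}"
    by (rule CollectI, rule exI[of _ "{}"], rule exI[of _ "{}"]) auto
  then show ?thesis
    unfolding homeo_space_def topology_generated_by_topspace by blast
qed

definition discrete_in :: "'a topology \<Rightarrow> 'a set \<Rightarrow> bool" where
  "discrete_in Y A \<longleftrightarrow> A \<subseteq> topspace Y \<and> subtopology Y A = discrete_topology A"

end

theory Submission
  imports Defs
begin

text \<open>By translation it suffices to find, for homeomorphisms \<open>k\<^sub>n\<close> each different from the
  identity, a neighbourhood of the identity containing none of them. As \<open>X\<close> is crowded, one can
  choose points \<open>x\<^sub>n\<close> such that \<open>x\<^sub>n \<noteq> k\<^sub>m x\<^sub>m\<close> for all \<open>n\<close> and \<open>m\<close>. Separating these countably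
  many pairs puts \<open>x\<^sub>n\<close> into a \<open>G\<^sub>\<delta>\<close>-set, whose nonempty interior yields clopen sets \<open>W\<^sub>n\<close> such that
  \<open>P = \<Union>\<^sub>n W\<^sub>n\<close> and \<open>Q = \<Union>\<^sub>n k\<^sub>n(W\<^sub>n)\<close> are disjoint. Since \<open>P \<union> Q\<close> is a cozero-set, some
  continuous \<open>g\<close> is 1 on \<open>P\<close> and 0 on \<open>Q\<close>, and then no \<open>k\<^sub>n\<close> maps \<open>{g \<ge> 1}\<close> into
  \<open>{g > 1/2}\<close>.\<close>

section \<open>Continuous functions, clopen sets and separation in F-spaces\<close>

lemma continuous_map_real_local:
  assumes "\<And>x e. x \<in> topspace X \<Longrightarrow> e > 0 \<Longrightarrow>
             \<exists>U. openin X U \<and> x \<in> U \<and> (\<forall>y\<in>U. \<bar>f y - f x\<bar> < e)"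
  shows "continuous_map X euclideanreal f"
  unfolding continuous_map_eq_topcontinuous_at topcontinuous_at_def
proof (intro ballI conjI allI impI)
  fix x V assume x: "x \<in> topspace X" and V: "openin euclideanreal V \<and> f x \<in> V"
  then obtain e where e: "e > 0" "\<And>z. \<bar>z - f x\<bar> < e \<Longrightarrow> z \<in> V"
    by (auto simp: open_dist dist_real_def)
  then show "\<exists>U. openin X U \<and> x \<in> U \<and> (\<forall>y\<in>U. f y \<in> V)"
    using assms[OF x e(1)] by blast
qed auto

text \<open>The witness takes the value \<open>1 / (n + 1)\<close> where \<open>n\<close> is the
  first index with \<open>x\<close> in \<open>W n\<close>, and 0 off the union. It is locally
  constant on the union, and it is small off any long finite union of the \<open>W n\<close>, which
  gives continuity at its zeros.\<close>

lemma cozero_in_UN_clopen: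
  fixes W :: "nat \<Rightarrow> 'a set"
  assumes op: "\<And>n. openin X (W n)" and cl: "\<And>n. closedin X (W n)"
  shows "cozero_in X (\<Union>n. W n)"
proof -
  define f :: "'a \<Rightarrow> real"
    where "f x = (if x \<in> (\<Union>n. W n) then 1 / real (Suc (LEAST n. x \<in> W n)) else 0)" for x
  have "continuous_map X euclideanreal f"
  proof (rule continuous_map_real_local)
    fix x and e :: real assume x: "x \<in> topspace X" and e: "e > 0"
    show "\<exists>U. openin X U \<and> x \<in> U \<and> (\<forall>y\<in>U. \<bar>f y - f x\<bar> < e)"
    proof (cases "x \<in> (\<Union>n. W n)")
      case True
      define k where "k = (LEAST n. x \<in> W n)"
      \<comment> \<open>On this clopen set the first index is constantly \<open>k\<close>.\<close>
      define U where "U = W k - (\<Union>m<k. W m)"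
      have "x \<in> W k"
        unfolding k_def using True by (metis LeastI UN_E)
      moreover have "x \<notin> W m" if "m < k" for m
        using not_less_Least that unfolding k_def by blast
      ultimately have "x \<in> U" by (auto simp: U_def)
      moreover have "openin X U"
        unfolding U_def by (intro openin_diff op closedin_Union) (auto simp: cl)
      moreover have "f y = 1 / real (Suc k)" if "y \<in> U" for y
      proof -
        have "(LEAST n. y \<in> W n) = k"
          using that by (intro Least_equality) (auto simp: U_def not_less[symmetric])
        then show ?thesis using that by (auto simp: f_def U_def)
      qed
      ultimately show ?thesis using e by (intro exI[of _ U]) auto
    next
      case False
      obtain N where N: "1 / real (Suc N) < e"
        using e reals_Archimedean by (metis inverse_eq_divide)
      \<comment> \<open>Points of \<open>U\<close> have first index at least \<open>N\<close>, if
        any, so \<open>f\<close> is at most \<open>1 / (N + 1)\<close> there.\<close>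
      define U where "U = topspace X - (\<Union>m<N. W m)"
      have "openin X U"
        unfolding U_def by (intro openin_diff closedin_Union) (auto simp: cl)
      moreover have "x \<in> U" using x False by (auto simp: U_def)
      moreover have "\<bar>f y - f x\<bar> < e" if y: "y \<in> U" for y
      proof (cases "y \<in> (\<Union>n. W n)")
        case True
        then have "y \<in> W (LEAST n. y \<in> W n)" by (metis LeastI UN_E)
        then have "N \<le> (LEAST n. y \<in> W n)"
          using y by (auto simp: U_def not_less[symmetric])
        then have "f y \<le> 1 / real (Suc N)" "f y \<ge> 0"
          using True by (auto simp: f_def intro!: divide_left_mono)
        then show ?thesis using N False by (simp add: f_def)
      qed (use False e in \<open>simp add: f_def\<close>)
      ultimately show ?thesis by blast
    qed
  qed
  moreover have "(\<Union>n. W n) = {x \<in> topspace X. f x \<noteq> 0}"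
    using openin_subset[OF op] by (auto simp: f_def)
  ultimately show ?thesis unfolding cozero_in_def by blast
qed

text \<open>Removing all but one point from a finite open set removes a closed set and would leave
  an isolated point.\<close>

lemma crowded_openin_infinite:
  assumes "crowded_space X" "Hausdorff_space X" "openin X U" "U \<noteq> {}"
  shows "infinite U"
proof
  assume fin: "finite U"
  obtain x where x: "x \<in> U" using assms(4) by blast
  have "closedin X (U - {x})"
    using assms(2,3) fin openin_subset by (intro closedin_Hausdorff_finite) auto
  with assms(3) have "openin X (U - (U - {x}))" by (rule openin_diff)
  moreover have "U - (U - {x}) = {x}" using x by blast
  ultimately show False
    using assms(1,3) x openin_subset unfolding crowded_space_def by (metis subsetD)
qed

lemma zero_dimensional_gdelta_clopen:
  assumes zd: "zero_dimensional_space X"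
    and gd: "\<forall>S. gdelta_in X S \<longrightarrow> S \<noteq> {} \<longrightarrow> X interior_of S \<noteq> {}"
    and S: "gdelta_in X S" "S \<noteq> {}"
  obtains W where "openin X W" "closedin X W" "W \<noteq> {}" "W \<subseteq> S"
proof -
  obtain x where x: "x \<in> X interior_of S" using gd S by blast
  have "(arbitrary union_of (\<lambda>U. openin X U \<and> closedin X U)) (X interior_of S)"
    using zd openin_interior_of unfolding zero_dimensional_space_def by metis
  then obtain W where "openin X W" "closedin X W" "x \<in> W" "W \<subseteq> X interior_of S"
    using x unfolding union_of_def arbitrary_def by blast
  then show ?thesis using that[of W] interior_of_subset[of X S] by blast
qed

text \<open>Since \<open>P\<close> and \<open>Q\<close> are open and disjoint, the indicator of
  \<open>P\<close> is continuous on \<open>P \<union> Q\<close>; it is bounded, so it extends over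
  the space.\<close>

lemma F_space_separation:
  assumes F: "F_space X" and coz: "cozero_in X (P \<union> Q)"
    and P: "openin X P" and Q: "openin X Q" and disj: "P \<inter> Q = {}"
  obtains g where "continuous_map X euclideanreal g"
    "\<And>x. x \<in> P \<Longrightarrow> g x = 1" "\<And>x. x \<in> Q \<Longrightarrow> g x = 0"
proof -
  let ?f = "indicat_real P"
  have "continuous_map (subtopology X (P \<union> Q)) euclideanreal ?f"
  proof (rule continuous_map_real_local)
    fix x and e :: real assume "x \<in> topspace (subtopology X (P \<union> Q))" and e: "e > 0"
    then consider "x \<in> P" | "x \<in> Q" by auto
    then show "\<exists>U. openin (subtopology X (P \<union> Q)) U \<and> x \<in> U \<and> (\<forall>y\<in>U. \<bar>?f y - ?f x\<bar> < e)"
    proof cases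
      case 1
      with P Q e show ?thesis
        by (intro exI[of _ P]) (auto simp: openin_open_subtopology openin_Un)
    next
      case 2
      then have "\<forall>y\<in>Q. ?f y = 0" using disj by (auto simp: indicator_def)
      with 2 P Q e show ?thesis
        by (intro exI[of _ Q]) (auto simp: openin_open_subtopology openin_Un)
    qed
  qed
  moreover have "bounded (?f ` (P \<union> Q))"
    by (rule finite_imp_bounded, rule finite_subset[of _ "{0,1}"]) (auto simp: indicator_def)
  moreover have "C_star_embedded_in X (P \<union> Q)"
    using F coz unfolding F_space_def by blast
  ultimately obtain g where g: "continuous_map X euclideanreal g" "\<forall>x\<in>P \<union> Q. g x = ?f x"
    unfolding C_star_embedded_in_def by blast
  show ?thesis
    using g disj by (intro that[of g]) (auto simp: indicator_def)
qed

section \<open>Points and clopen sets displaced by a sequence of homeomorphisms\<close>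

text \<open>The points are chosen recursively: the set moved by \<open>k n\<close> is open and
  nonempty, hence infinite, while the earlier choices forbid only finitely many points.\<close>

lemma moved_points_sequence:
  fixes k :: "nat \<Rightarrow> 'a \<Rightarrow> 'a"
  assumes cr: "crowded_space X" and hd: "Hausdorff_space X"
    and hom: "\<And>n. homeomorphic_map X X (k n)"
    and moved: "\<And>n. \<exists>x\<in>topspace X. k n x \<noteq> x"
  obtains x where "\<And>n. x n \<in> topspace X" "\<And>n m. x n \<noteq> k m (x m)"
proof -
  \<comment> \<open>Each new point is compared with the earlier ones in both directions, so that the
    three inequalities settle equal, larger and smaller indices.\<close>
  define P where "P f n r \<longleftrightarrow> r \<in> topspace X \<and> k n r \<noteq> r \<and>
      (\<forall>m<n. r \<noteq> k m (f m) \<and> k n r \<noteq> f m)" for f :: "nat \<Rightarrow> 'a" and n r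
  have "\<exists>f. \<forall>n. P f n (f n)"
  proof (rule dependent_wellorder_choice)
    show "P f n r = P g n r" if "\<And>y. y < n \<Longrightarrow> f y = g y" for r f g n
      using that by (simp add: P_def)
  next
    fix n :: nat and f :: "nat \<Rightarrow> 'a"
    have cont: "continuous_map X X (k n)" and inj: "inj_on (k n) (topspace X)"
      using hom by (auto simp: homeomorphic_eq_everything_map)
    let ?M = "{x \<in> topspace X. k n x \<noteq> x}"
    have "openin X (topspace X - {x \<in> topspace X. k n x = x})"
      using closedin_continuous_maps_eq[OF hd cont continuous_map_id] by auto
    moreover have "topspace X - {x \<in> topspace X. k n x = x} = ?M" by blast
    ultimately have "infinite ?M"
      using crowded_openin_infinite[OF cr hd, of ?M] moved[of n] by auto
    \<comment> \<open>The second set is finite because \<open>k n\<close> is injective.\<close>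
    moreover have "finite ((\<lambda>m. k m (f m)) ` {..<n} \<union> {x \<in> topspace X. k n x \<in> f ` {..<n}})"
      using finite_vimage_IntI[of "f ` {..<n}" "k n" "topspace X"] inj
      by (simp add: vimage_def Int_def conj_commute)
    ultimately obtain r where "r \<in> ?M"
        "r \<notin> (\<lambda>m. k m (f m)) ` {..<n} \<union> {x \<in> topspace X. k n x \<in> f ` {..<n}}"
      by (meson finite_subset subsetI)
    then show "\<exists>r. P f n r" by (auto simp: P_def)
  qed
  then obtain x where x: "\<And>n. P x n (x n)" by blast
  have "x n \<noteq> k m (x m)" for n m
    using x[of n] x[of m] unfolding P_def by (metis linorder_less_linear)
  with x that show ?thesis unfolding P_def by blast
qed

lemma clopen_family_disjoint_images:
  fixes k :: "nat \<Rightarrow> 'a \<Rightarrow> 'a"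
  assumes hd: "Hausdorff_space X" and zd: "zero_dimensional_space X"
    and gd: "\<forall>S. gdelta_in X S \<longrightarrow> S \<noteq> {} \<longrightarrow> X interior_of S \<noteq> {}"
    and cont: "\<And>n. continuous_map X X (k n)"
    and x: "\<And>n. x n \<in> topspace X" and neq: "\<And>n m. x n \<noteq> k m (x m)"
  obtains W where "\<And>n. openin X (W n)" "\<And>n. closedin X (W n)" "\<And>n. W n \<noteq> {}"
    "\<And>n m. W n \<inter> k m ` W m = {}"
proof -
  have kx: "k m (x m) \<in> topspace X" for m
    using continuous_map_image_subset_topspace[OF cont] x by blast
  have "\<exists>U V. openin X U \<and> openin X V \<and> x n \<in> U \<and> k m (x m) \<in> V \<and> U \<inter> V = {}" for n m
    using hd x kx neq[of n m] unfolding Hausdorff_space_def disjnt_def by metis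
  then obtain U V where U: "\<And>n m. openin X (U n m)" and V: "\<And>n m. openin X (V n m)"
    and xU: "\<And>n m. x n \<in> U n m" and xV: "\<And>n m. k m (x m) \<in> V n m"
    and UV: "\<And>n m. U n m \<inter> V n m = {}"
    by metis
  \<comment> \<open>The indices of \<open>V\<close> are swapped: \<open>V m n\<close> is the
    neighbourhood of \<open>k n (x n)\<close> that misses the neighbourhood \<open>U m n\<close> of
    \<open>x m\<close>. Thus \<open>V' n m\<close> is a neighbourhood of \<open>x n\<close>.\<close>
  define V' where "V' n m = {z \<in> topspace X. k n z \<in> V m n}" for n m
  have V': "openin X (V' n m)" for n m
    unfolding V'_def using cont V by (rule openin_continuous_map_preimage)
  have "\<exists>W. openin X W \<and> closedin X W \<and> W \<noteq> {} \<and> W \<subseteq> (\<Inter>m. U n m \<inter> V' n m)" for n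
  proof -
    have "gdelta_in X (\<Inter>m. U n m \<inter> V' n m)"
      by (rule gdelta_in_Inter) (auto intro!: open_imp_gdelta_in openin_Int U V')
    moreover from x xU xV have "x n \<in> (\<Inter>m. U n m \<inter> V' n m)"
      by (auto simp: V'_def)
    then have "(\<Inter>m. U n m \<inter> V' n m) \<noteq> {}" by blast
    ultimately obtain W where "openin X W" "closedin X W" "W \<noteq> {}"
        "W \<subseteq> (\<Inter>m. U n m \<inter> V' n m)"
      by (rule zero_dimensional_gdelta_clopen[OF zd gd])
    then show ?thesis by blast
  qed
  then obtain W where W: "\<And>n. openin X (W n)" "\<And>n. closedin X (W n)" "\<And>n. W n \<noteq> {}"
    and sub: "\<And>n. W n \<subseteq> (\<Inter>m. U n m \<inter> V' n m)"
    by metis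
  \<comment> \<open>Here \<open>W n\<close> lies in \<open>U n m\<close>, and \<open>W m\<close>
    lies in \<open>V' m n\<close>, so that \<open>k m\<close> maps it into
    \<open>V n m\<close>.\<close>
  have "W n \<inter> k m ` W m = {}" for n m
    using sub[of n] sub[of m] UV[of n m] unfolding V'_def by blast
  with W that show ?thesis by blast
qed

lemma identity_neighbourhood_avoiding_sequence:
  fixes k :: "nat \<Rightarrow> 'a \<Rightarrow> 'a"
  assumes cr: "crowded_space X" and comp: "compact_space X" and hd: "Hausdorff_space X"
    and zd: "zero_dimensional_space X" and F: "F_space X"
    and gd: "\<forall>S. gdelta_in X S \<longrightarrow> S \<noteq> {} \<longrightarrow> X interior_of S \<noteq> {}"
    and hom: "\<And>n. homeomorphic_map X X (k n)"
    and moved: "\<And>n. \<exists>x\<in>topspace X. k n x \<noteq> x"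
  obtains K U where "compactin X K" "openin X U" "K \<subseteq> U" "\<And>n. \<not> k n ` K \<subseteq> U"
proof -
  obtain x where x: "\<And>n. x n \<in> topspace X" "\<And>n m. x n \<noteq> k m (x m)"
    by (rule moved_points_sequence[where k = k, OF cr hd hom moved]) (rule that)
  obtain W where W: "\<And>n. openin X (W n)" "\<And>n. closedin X (W n)" "\<And>n. W n \<noteq> {}"
    and disj: "\<And>n m. W n \<inter> k m ` W m = {}"
    by (rule clopen_family_disjoint_images[where k = k and x = x,
          OF hd zd gd homeomorphic_imp_continuous_map[OF hom] x]) (rule that)
  have kW: "openin X (k n ` W n)" "closedin X (k n ` W n)" for n
    using hom W openin_subset homeomorphic_map_openness homeomorphic_map_closedness by metis+
  let ?P = "\<Union>n. W n" and ?Q = "\<Union>n. k n ` W n"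
  \<comment> \<open>Pairing each \<open>W n\<close> with its image gives a single sequence of clopen
    sets.\<close>
  have "cozero_in X (\<Union>n. W n \<union> k n ` W n)"
    by (rule cozero_in_UN_clopen) (auto intro: W kW)
  then have "cozero_in X (?P \<union> ?Q)" by (simp add: UN_Un_distrib)
  moreover have "openin X ?P" "openin X ?Q" using W kW by auto
  moreover have "?P \<inter> ?Q = {}" using disj by blast
  ultimately obtain g where g: "continuous_map X euclideanreal g"
    and g1: "\<And>x. x \<in> ?P \<Longrightarrow> g x = 1" and g0: "\<And>x. x \<in> ?Q \<Longrightarrow> g x = 0"
    by (rule F_space_separation[OF F]) (rule that)
  let ?K = "{x \<in> topspace X. g x \<in> {1..}}" and ?U = "{x \<in> topspace X. g x \<in> {1/2<..}}"
  show ?thesis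
  proof (rule that)
    show "compactin X ?K"
      by (intro closedin_compact_space comp closedin_continuous_map_preimage[OF g]) simp
    show "openin X ?U"
      by (intro openin_continuous_map_preimage[OF g]) simp
    show "?K \<subseteq> ?U" by auto
    show "\<not> k n ` ?K \<subseteq> ?U" for n
    proof -
      obtain w where w: "w \<in> W n" using W(3) by blast
      then have "w \<in> ?K" using openin_subset[OF W(1)] g1 by force
      moreover have "k n w \<notin> ?U" using g0[of "k n w"] w by force
      ultimately show ?thesis by blast
    qed
  qed
qed

section \<open>Neighbourhoods and countable subsets in the homeomorphism group\<close>

text \<open>Composing the members of \<open>B\<close> with the inverse of \<open>h\<close> reduces
  the claim to avoiding a sequence of non-identity homeomorphisms near the identity.\<close>

lemma homeo_neighbourhood_avoiding_countable:
  assumes cr: "crowded_space X" and comp: "compact_space X" and hd: "Hausdorff_space X"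
    and zd: "zero_dimensional_space X" and F: "F_space X"
    and gd: "\<forall>S. gdelta_in X S \<longrightarrow> S \<noteq> {} \<longrightarrow> X interior_of S \<noteq> {}"
    and h: "h \<in> homeomorphisms X" and B: "B \<subseteq> homeomorphisms X" "countable B" "h \<notin> B"
  obtains N where "openin (homeo_space X) N" "h \<in> N" "N \<inter> B = {}"
proof (cases "B = {}")
  case True
  with h that[of "topspace (homeo_space X)"] show ?thesis
    by (simp add: topspace_homeo_space[symmetric])
next
  case False
  obtain g where hg: "homeomorphic_maps X X h g"
    using h unfolding homeomorphisms_def homeomorphic_map_maps by blast
  \<comment> \<open>The enumeration may repeat values, so finite nonempty \<open>B\<close> is
    covered too.\<close>
  define b where "b = from_nat_into B"
  have bB: "b n \<in> B" for n unfolding b_def by (simp add: False from_nat_into)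
  have homb: "homeomorphic_map X X (b n)" and extb: "b n \<in> extensional (topspace X)" for n
    using B(1) bB[of n] by (auto simp: homeomorphisms_def)
  have b_top: "b n x \<in> topspace X" if "x \<in> topspace X" for n x
    using homeomorphic_imp_surjective_map[OF homb[of n]] that by blast
  define k where "k n = g \<circ> b n" for n
  have homk: "homeomorphic_map X X (k n)" for n
    unfolding k_def using hg homb homeomorphic_map_compose homeomorphic_maps_map by metis
  \<comment> \<open>If \<open>k n\<close> fixed every point, \<open>b n\<close> and \<open>h\<close>
    would agree on the space, and by extensionality everywhere, although \<open>h\<close> is not in
    \<open>B\<close>.\<close>
  have moved: "\<exists>x\<in>topspace X. k n x \<noteq> x" for n
  proof (rule ccontr)
    assume "\<not> ?thesis"
    then have "b n x = h x" if "x \<in> topspace X" for x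
      using that hg b_top[OF that] unfolding k_def homeomorphic_maps_map by (metis comp_apply)
    then have "b n = h"
      using extb h by (intro extensionalityI[of _ "topspace X"]) (auto simp: homeomorphisms_def)
    with bB B(3) show False by metis
  qed
  obtain K U where K: "compactin X K" and U: "openin X U" and KU: "K \<subseteq> U"
    and no: "\<And>n. \<not> k n ` K \<subseteq> U"
    by (rule identity_neighbourhood_avoiding_sequence[where k = k, OF cr comp hd zd F gd homk moved])
      (rule that)
  \<comment> \<open>The left translate by \<open>h\<close> of the subbasic neighbourhood of the
    identity given by \<open>K\<close> and \<open>U\<close>.\<close>
  let ?N = "{f \<in> homeomorphisms X. f ` K \<subseteq> h ` U}"
  have "openin X (h ` U)"
    using U hg homeomorphic_map_openness openin_subset unfolding homeomorphic_maps_map by metis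
  then have "openin (homeo_space X) ?N"
    unfolding homeo_space_def by (intro topology_generated_by_Basis) (use K in blast)
  moreover have "h \<in> ?N" using h KU by blast
  moreover have "?N \<inter> B = {}"
  proof -
    have "f \<notin> ?N" if fB: "f \<in> B" for f
    proof
      assume f: "f \<in> ?N"
      obtain n where n: "f = b n"
        using from_nat_into_surj[OF B(2) fB] unfolding b_def by blast
      have "k n ` K = g ` b n ` K" by (simp add: k_def image_comp)
      also have "\<dots> \<subseteq> g ` h ` U" using f n by (intro image_mono) simp
      also have "\<dots> = U"
        using hg openin_subset[OF U] unfolding homeomorphic_maps_map image_image
        by (simp add: subset_iff cong: image_cong)
      finally show False using no by blast
    qed
    then show ?thesis by blast
  qed
  ultimately show ?thesis by (rule that)
qed

theorem proposition5p6:
  fixes X :: "'a topology"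
  assumes "crowded_space X"
    and "compact_space X"
    and "Hausdorff_space X"
    and "zero_dimensional_space X"
    and "F_space X"
    and "\<And>S. gdelta_in X S \<Longrightarrow> S \<noteq> {} \<Longrightarrow> X interior_of S \<noteq> {}"
  shows "\<forall>A. A \<subseteq> homeomorphisms X \<and> countable A \<longrightarrow>
           discrete_in (homeo_space X) A \<and> closedin (homeo_space X) A"
proof (intro allI impI)
  fix A assume A: "A \<subseteq> homeomorphisms X \<and> countable A"
  have gd: "\<forall>S. gdelta_in X S \<longrightarrow> S \<noteq> {} \<longrightarrow> X interior_of S \<noteq> {}"
    using assms(6) by blast
  \<comment> \<open>Absence of accumulation points yields discreteness and closedness at once;
    \<open>h\<close> itself may belong to \<open>A\<close>, so it is removed first.\<close>
  have "h \<notin> homeo_space X derived_set_of A" for h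
  proof
    assume h: "h \<in> homeo_space X derived_set_of A"
    then have "h \<in> homeomorphisms X"
      by (simp add: in_derived_set_of topspace_homeo_space)
    moreover have "A - {h} \<subseteq> homeomorphisms X" "countable (A - {h})" "h \<notin> A - {h}"
      using A by auto
    ultimately obtain N where "openin (homeo_space X) N" "h \<in> N" "N \<inter> (A - {h}) = {}"
      using homeo_neighbourhood_avoiding_countable[OF assms(1-5) gd] by metis
    with h show False unfolding in_derived_set_of by blast
  qed
  then have "homeo_space X derived_set_of A = {}" by blast
  with A show "discrete_in (homeo_space X) A \<and> closedin (homeo_space X) A"
    by (simp add: discrete_in_def subtopology_eq_discrete_topology_eq
        closedin_contains_derived_set topspace_homeo_space)
qed

end
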